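(* Let $X=(X_1,\ldots,X_N)$ denote binary treatments assigned by sampling without replacement, and let $Y=(Y_1,\ldots,Y_N)$ denote binary outcomes generated under arbitrary interference. Then with probability converging to at least $1-\alpha$, it holds that $$\tau^{\mathrm{CAT}}\ge \Delta_Y-\frac{z_{1-\alpha}}{2}\sqrt{\frac{N}{N_0N_1}},$$ as well as $$|\tau^{\mathrm{CAT}}-\Delta_Y|\le\frac{z_{1-\alpha/2}}{2}\sqrt{\frac{N}{N_0N_1}},$$ implying that $\Delta_Y=\tau^{\mathrm{CAT}}+o_P(1)$ as $\min(N_1,N_0)\to\infty$.
   Context: There are $N$ units; $X_i=1$ means unit $i$ is treated and $X_i=0$ that it is in control. $N_1=\sum_{i=1}^N 1\{X_i=1\}$ and $N_0=\sum_{i=1}^N 1\{X_i=0\}$ are the numbers of treated and control units. Arbitrary interference means that each outcome is an idiosyncratic function of all $N$ treatments, $Y_i=f_i(X_1,\ldots,X_N)$, with no restriction on the functions $f_i$ other than that the outcomes are binary. $\xi_i=f_i(0,\ldots,0)$ is the counterfactual outcome of unit $i$ under full control. Define $$\Delta_Y=\frac1{N_1}\sum_{i:X_i=1}Y_i-\frac1{N_0}\sum_{i:X_i=0}Y_i,\qquad \Delta_\xi=\frac1{N_1}\sum_{i:X_i=1}\xi_i-\frac1{N_0}\sum_{i:X_i=0}\xi_i,$$ and the contrast attributable to treatment $\tau^{\mathrm{CAT}}=\Delta_Y-\Delta_\xi$. $z_q$ is the $q$-quantile of the standard normal distribution. The limit regime is $\min(N_1,N_0)\to\infty$.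
   Formalization: The one-sided bound is stated only for α < 1/2 (for α ≥ 1/2 it can fail, e.g. when all outcomes are 0 and α > 1/2); the two-sided bound is for all α in (0,1); the two bounds are separate claims, each at level 1−α, since jointly they can fail. *)

theory Defs
  imports "HOL-Probability.Probability"
begin

text \<open>Units are \<open>1, \<dots>, N\<close>. A treatment assignment is an extensional 0/1-valued function on
  \<open>{1..N}\<close>, so that the potential outcome \<open>f i x\<close> of unit \<open>i\<close> is an arbitrary function of exactly
  the \<open>N\<close> treatments.\<close>

definition assignments :: "nat \<Rightarrow> (nat \<Rightarrow> nat) set" where
  "assignments N = ({1..N} \<rightarrow>\<^sub>E {0, 1})"

definition full_control :: "nat \<Rightarrow> nat \<Rightarrow> nat" where
  "full_control N = (\<lambda>i\<in>{1..N}. 0)"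

definition arm :: "nat \<Rightarrow> (nat \<Rightarrow> nat) \<Rightarrow> nat \<Rightarrow> nat set" where
  "arm N x t = {i \<in> {1..N}. x i = t}"

definition binary_outcomes :: "nat \<Rightarrow> (nat \<Rightarrow> (nat \<Rightarrow> nat) \<Rightarrow> real) \<Rightarrow> bool" where
  "binary_outcomes N f \<longleftrightarrow> (\<forall>i\<in>{1..N}. \<forall>x\<in>assignments N. f i x \<in> {0, 1})"

definition diff_in_means :: "nat \<Rightarrow> (nat \<Rightarrow> nat) \<Rightarrow> (nat \<Rightarrow> real) \<Rightarrow> real" where
  "diff_in_means N x v =
     (1 / real (card (arm N x 1))) * (\<Sum>i\<in>arm N x 1. v i)
     - (1 / real (card (arm N x 0))) * (\<Sum>i\<in>arm N x 0. v i)"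

definition Delta_Y :: "nat \<Rightarrow> (nat \<Rightarrow> (nat \<Rightarrow> nat) \<Rightarrow> real) \<Rightarrow> (nat \<Rightarrow> nat) \<Rightarrow> real" where
  "Delta_Y N f x = diff_in_means N x (\<lambda>i. f i x)"

definition Delta_xi :: "nat \<Rightarrow> (nat \<Rightarrow> (nat \<Rightarrow> nat) \<Rightarrow> real) \<Rightarrow> (nat \<Rightarrow> nat) \<Rightarrow> real" where
  "Delta_xi N f x = diff_in_means N x (\<lambda>i. f i (full_control N))"

definition tau_CAT :: "nat \<Rightarrow> (nat \<Rightarrow> (nat \<Rightarrow> nat) \<Rightarrow> real) \<Rightarrow> (nat \<Rightarrow> nat) \<Rightarrow> real" where
  "tau_CAT N f x = Delta_Y N f x - Delta_xi N f x"

text \<open>\<open>X\<close> is a random assignment drawn uniformly from those treating exactly \<open>N1\<close> of the \<open>N\<close> units.\<close>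

definition sampled_without_replacement ::
    "'w measure \<Rightarrow> nat \<Rightarrow> nat \<Rightarrow> ('w \<Rightarrow> nat \<Rightarrow> nat) \<Rightarrow> bool" where
  "sampled_without_replacement M N N1 X \<longleftrightarrow>
     prob_space M \<and>
     X \<in> M \<rightarrow>\<^sub>M count_space (assignments N) \<and>
     distr M (count_space (assignments N)) X =
       uniform_measure (count_space (assignments N)) {x \<in> assignments N. card (arm N x 1) = N1}"

definition quantile :: "real measure \<Rightarrow> real \<Rightarrow> real" where
  "quantile D q = Inf {x. q \<le> cdf D x}"

definition z_quantile :: "real \<Rightarrow> real" where
  "z_quantile q = quantile std_normal_distribution q"

text \<open>\<open>Z n = o\<^sub>P(1)\<close>, where each \<open>Z n\<close> may live on its own probability space.\<close>

definition little_oP_one :: "(nat \<Rightarrow> 'w measure) \<Rightarrow> (nat \<Rightarrow> 'w \<Rightarrow> real) \<Rightarrow> bool" where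
  "little_oP_one M Z \<longleftrightarrow>
     (\<forall>\<epsilon>>0. (\<lambda>n. measure (M n) {\<omega> \<in> space (M n). \<bar>Z n \<omega>\<bar> > \<epsilon>}) \<longlonglongrightarrow> 0)"

end

theory Submission
  imports Defs
begin

text \<open>Since \<open>\<tau>\<^sup>C\<^sup>A\<^sup>T - \<Delta>\<^sub>Y = - \<Delta>\<^sub>\<xi>\<close> and \<open>\<xi>\<close> does not depend on the assignment, only \<open>\<Delta>\<^sub>\<xi>\<close> matters. It equals
  \<open>N / (N\<^sub>0 N\<^sub>1)\<close> times a centred hypergeometric variable \<open>D\<close>, whose variance is largest when half of
  the \<open>\<xi>\<^sub>i\<close> are \<open>1\<close>; this maximum gives the width of the bounds.

  The central limit theorem for \<open>D\<close> comes from Stein's identity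
  \<open>N E[D h(D)] = E[b (h(D + 1) - h(D))]\<close>, where \<open>b\<close> counts the exchanges of a sampled and an unsampled
  unit that raise \<open>D\<close> by one. As \<open>b\<close> is concentrated around \<open>N Var D\<close>, taking \<open>h(x) = exp (i t x)\<close> turns
  the identity into an approximate differential equation \<open>\<phi>' = - s \<phi>\<close> for the characteristic function
  of \<open>D\<close> divided by its standard deviation, with an error that vanishes as \<open>Var D\<close> grows.

  If the variance does not grow, normal approximation fails. But along any subsequence on which the
  non-coverage probability stays bounded away from \<open>0\<close>, Chebyshev's inequality forces \<open>Var D\<close> to be
  of the order \<open>N\<^sub>0 N\<^sub>1 / N\<close>, which tends to infinity.\<close>

section \<open>Stein's identity for the hypergeometric distribution\<close>

locale simple_random_sample =
  fixes U A :: "'a set" and n :: nat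
  assumes finite_U: "finite U" and A_subset: "A \<subseteq> U" and n_le: "n \<le> card U" and U_nonempty: "U \<noteq> {}"
begin

definition samples :: "'a set set" where
  "samples = {S. S \<subseteq> U \<and> card S = n}"

definition P :: "'a set pmf" where
  "P = pmf_of_set samples"

definition dev :: "'a set \<Rightarrow> real" where
  "dev S = real (card (S \<inter> A)) - real n * real (card A) / real (card U)"

definition var :: real where
  "var = measure_pmf.expectation P (\<lambda>S. (dev S)\<^sup>2)"

text \<open>This is the count \<open>b\<close> of the overview: pairs of a unit of \<open>A\<close>
  outside \<open>S\<close> and a unit of \<open>S\<close> outside \<open>A\<close>.\<close>

definition swaps :: "'a set \<Rightarrow> real" where
  "swaps S = real (card (A - S)) * real (card (S - A))"

lemma finite_samples: "finite samples"
  unfolding samples_def using finite_U by auto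

lemma samples_nonempty: "samples \<noteq> {}"
  using obtain_subset_with_card_n[OF n_le] unfolding samples_def by blast

lemma set_P [simp]: "set_pmf P = samples"
  unfolding P_def using finite_samples samples_nonempty by simp

lemma integrable_P [simp, intro]:
  fixes h :: "'a set \<Rightarrow> 'b::{banach, second_countable_topology}"
  shows "integrable (measure_pmf P) h"
  by (rule integrable_measure_pmf_finite) (simp add: finite_samples)

lemma expectation_P:
  fixes h :: "'a set \<Rightarrow> 'b::{banach, second_countable_topology}"
  shows "measure_pmf.expectation P h = (\<Sum>S\<in>samples. h S) /\<^sub>R real (card samples)"
proof -
  have "measure_pmf.expectation P h = (\<Sum>S\<in>samples. pmf P S *\<^sub>R h S)"
    by (rule integral_measure_pmf) (simp_all add: finite_samples)
  also have "\<dots> = (\<Sum>S\<in>samples. (1 / real (card samples)) *\<^sub>R h S)"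
    by (rule sum.cong)
       (use finite_samples samples_nonempty in \<open>simp_all add: P_def\<close>)
  finally show ?thesis
    by (simp add: scaleR_sum_right divide_inverse)
qed

lemma expectation_P_cong:
  assumes "\<And>S. S \<in> samples \<Longrightarrow> h S = h' S"
  shows "measure_pmf.expectation P h = measure_pmf.expectation P h'"
  by (intro integral_cong_AE) (use assms in \<open>auto simp: AE_measure_pmf_iff\<close>)

lemma expectation_P_mono:
  fixes h h' :: "'a set \<Rightarrow> real"
  assumes "\<And>S. S \<in> samples \<Longrightarrow> h S \<le> h' S"
  shows "measure_pmf.expectation P h \<le> measure_pmf.expectation P h'"
  by (intro integral_mono_AE) (use assms in \<open>auto simp: AE_measure_pmf_iff\<close>)

text \<open>Both sides count pairs of a sample and an exchange: exchanging \<open>j \<in> S - A\<close> for \<open>i \<in> A - S\<close> is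
  undone by exchanging \<open>i\<close> for \<open>j\<close>.\<close>

lemma sum_swap_exchange:
  fixes h :: "nat \<Rightarrow> 'b::real_vector"
  shows "(\<Sum>S\<in>samples. swaps S *\<^sub>R h (Suc (card (S \<inter> A)))) =
    (\<Sum>S\<in>samples. (real (card (S \<inter> A)) * real (card (U - S - A))) *\<^sub>R h (card (S \<inter> A)))"
proof -
  let ?L = "SIGMA S:samples. (A - S) \<times> (S - A)"
  let ?R = "SIGMA S:samples. (S \<inter> A) \<times> (U - S - A)"
  have finS: "finite S" if "S \<in> samples" for S
    using that finite_U unfolding samples_def by (auto intro: finite_subset)
  have finA: "finite A"
    using finite_U A_subset by (rule rev_finite_subset)
  have "(\<Sum>S\<in>samples. swaps S *\<^sub>R h (Suc (card (S \<inter> A)))) =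
      (\<Sum>S\<in>samples. \<Sum>q\<in>(A - S) \<times> (S - A). h (Suc (card (S \<inter> A))))"
    by (simp add: swaps_def sum_constant_scaleR card_cartesian_product)
  also have "\<dots> = (\<Sum>(S, q)\<in>?L. h (Suc (card (S \<inter> A))))"
    by (rule sum.Sigma) (use finite_samples finS finA in auto)
  also have "\<dots> = (\<Sum>(S, q)\<in>?R. h (card (S \<inter> A)))"
  proof (rule sum.reindex_bij_witness[where
        i = "\<lambda>(S, i, j). (insert j (S - {i}), i, j)" and j = "\<lambda>(S, i, j). (insert i (S - {j}), i, j)"],
      goal_cases)
    case (1 a) then show ?case by auto
  next
    case (2 a)
    obtain S i j where a: "a = (S, i, j)" by (cases a)
    then have S: "S \<in> samples" "i \<in> A" "i \<notin> S" "j \<in> S" "j \<notin> A" using 2 by auto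
    have "insert i (S - {j}) \<in> samples"
      using S finS[OF S(1)] A_subset
      by (auto simp: samples_def card_insert_if) (metis card_Suc_Diff1 card_Diff_singleton One_nat_def)+
    then show ?case using S a by (auto simp: samples_def)
  next
    case (3 b) then show ?case by auto
  next
    case (4 b)
    obtain S i j where b: "b = (S, i, j)" by (cases b)
    then have S: "S \<in> samples" "i \<in> A" "i \<in> S" "j \<in> U" "j \<notin> S" "j \<notin> A" using 4 by auto
    have "insert j (S - {i}) \<in> samples"
      using S finS[OF S(1)] A_subset
      by (auto simp: samples_def card_insert_if) (metis card_Suc_Diff1 card_Diff_singleton One_nat_def)+
    then show ?case using S b by auto
  next
    case (5 a)
    obtain S i j where a: "a = (S, i, j)" by (cases a)
    then have S: "S \<in> samples" "i \<in> A" "i \<notin> S" "j \<in> S" "j \<notin> A" using 5 by auto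
    have "insert i (S - {j}) \<inter> A = insert i (S \<inter> A)" using S by auto
    then have "card (insert i (S - {j}) \<inter> A) = Suc (card (S \<inter> A))"
      using S finS[OF S(1)] by simp
    then show ?case using a by simp
  qed
  also have "\<dots> = (\<Sum>S\<in>samples. \<Sum>q\<in>(S \<inter> A) \<times> (U - S - A). h (card (S \<inter> A)))"
    by (rule sum.Sigma[symmetric]) (use finite_samples finS finite_U in auto)
  also have "\<dots> = (\<Sum>S\<in>samples. (real (card (S \<inter> A)) * real (card (U - S - A))) *\<^sub>R h (card (S \<inter> A)))"
    by (simp add: sum_constant_scaleR card_cartesian_product)
  finally show ?thesis .
qed

section \<open>Exchange counts of a fixed sample as polynomials in its deviation\<close>

context
  fixes S assumes S: "S \<in> samples"
begin

lemma finite_sample: "finite S" and sample_subset: "S \<subseteq> U" and card_sample: "card S = n"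
  using S finite_U unfolding samples_def by (auto intro: finite_subset)

lemma card_A_minus: "real (card (A - S)) = real (card A) - real (card (S \<inter> A))"
  using card_Int_Diff[of A S] finite_subset[OF A_subset finite_U] by (simp add: Int_commute)

lemma card_minus_A: "real (card (S - A)) = real n - real (card (S \<inter> A))"
  using card_Int_Diff[of S A] finite_sample card_sample by simp

lemma card_outside:
  "real (card (U - S - A)) = real (card U) - real n - real (card A) + real (card (S \<inter> A))"
proof -
  have "card (U - (S \<union> A)) + card (S \<union> A) = card U"
    using sample_subset A_subset finite_U
    by (metis card_Un_disjoint Diff_disjoint Diff_partition Un_least finite_subset Int_commute
        Un_commute finite_Diff)
  moreover have "card (S \<union> A) + card (S \<inter> A) = n + card A"
    using card_Un_Int[of S A] finite_sample card_sample finite_subset[OF A_subset finite_U] by simp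
  ultimately have "real (card (U - (S \<union> A))) + (real n + real (card A)) = real (card U) + real (card (S \<inter> A))"
    by linarith
  then show ?thesis by (simp add: set_diff_eq Un_def conj_ac)
qed

text \<open>Substituting \<open>card (S \<inter> A) = \<mu> + dev S\<close> into both factors makes
  the count a quadratic in the deviation, so that its mean and its fluctuation are controlled by
  moments of \<open>dev\<close>.\<close>

lemma swaps_eq:
  defines "\<mu> \<equiv> real n * real (card A) / real (card U)"
  shows "swaps S = (real n - \<mu>) * (real (card A) - \<mu>) - (real n + real (card A) - 2 * \<mu>) * dev S + (dev S)\<^sup>2"
  unfolding swaps_def card_A_minus card_minus_A dev_def \<mu>_def[symmetric]
  by (simp add: algebra_simps power2_eq_square)

text \<open>With \<open>k = card (S \<inter> A)\<close>, the quadratic terms of the two exchange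
  counts cancel and their difference is \<open>k * card U - n * card A\<close>. This linear
  remainder becomes the left side of Stein's identity.\<close>

lemma reverse_swaps_eq:
  "real (card (S \<inter> A)) * real (card (U - S - A)) = swaps S + real (card U) * dev S"
proof -
  have "real (card U) > 0" using finite_U U_nonempty by (simp add: card_gt_0_iff)
  then show ?thesis
    unfolding swaps_def card_A_minus card_minus_A card_outside dev_def
    by (simp add: algebra_simps)
qed

lemma abs_dev_le: "\<bar>dev S\<bar> \<le> real (card U)"
proof -
  have U: "real (card U) > 0" using finite_U U_nonempty by (simp add: card_gt_0_iff)
  have A: "card A \<le> card U" using finite_U A_subset by (rule card_mono)
  have "card (S \<inter> A) \<le> card A" using finite_subset[OF A_subset finite_U] by (simp add: card_mono)
  moreover have "real n * real (card A) / real (card U) \<le> real (card U)"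
    using U A n_le by (simp add: divide_le_eq mult_mono)
  ultimately show ?thesis
    unfolding dev_def using A by (simp add: abs_le_iff) (smt (verit) of_nat_0_le_iff divide_nonneg_nonneg mult_nonneg_nonneg of_nat_mono)
qed

end

lemma card_U_pos: "0 < real (card U)"
  using finite_U U_nonempty by (simp add: card_gt_0_iff)

text \<open>Double counting of exchanges replaces \<open>swaps\<close> weighted by
  \<open>h (dev + 1)\<close> by the reverse count weighted by \<open>h (dev)\<close>. The two counts
  differ by \<open>card U * dev\<close>.\<close>

lemma stein_identity:
  fixes h :: "real \<Rightarrow> 'b::{banach, second_countable_topology}"
  shows "real (card U) *\<^sub>R measure_pmf.expectation P (\<lambda>S. dev S *\<^sub>R h (dev S)) =
    measure_pmf.expectation P (\<lambda>S. swaps S *\<^sub>R (h (dev S + 1) - h (dev S)))"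
proof -
  \<comment> \<open>The exchange lemma takes functions of the integer count, so the centring is
    moved into \<open>g\<close>.\<close>
  define g where "g k = h (real k - real n * real (card A) / real (card U))" for k
  have g: "h (dev S) = g (card (S \<inter> A))" "h (dev S + 1) = g (Suc (card (S \<inter> A)))" for S
    unfolding g_def dev_def by (simp_all add: algebra_simps)
  have "(\<Sum>S\<in>samples. swaps S *\<^sub>R h (dev S + 1)) =
      (\<Sum>S\<in>samples. (swaps S + real (card U) * dev S) *\<^sub>R h (dev S))"
    unfolding g sum_swap_exchange by (rule sum.cong) (simp_all add: reverse_swaps_eq)
  then have "(\<Sum>S\<in>samples. swaps S *\<^sub>R (h (dev S + 1) - h (dev S))) =
      real (card U) *\<^sub>R (\<Sum>S\<in>samples. dev S *\<^sub>R h (dev S))"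
    by (simp add: scaleR_right_diff_distrib sum_subtractf scaleR_left_distrib sum.distrib scaleR_sum_right)
  then show ?thesis
    by (simp add: expectation_P scaleR_left_commute)
qed

text \<open>Constant and linear test functions in Stein's identity give the first moment of
  \<open>dev\<close> and the mean of \<open>swaps\<close>, without evaluating any binomial
  sum.\<close>

lemma expectation_dev: "measure_pmf.expectation P dev = 0"
  using stein_identity[of "\<lambda>_. 1::real"] card_U_pos by simp

lemma expectation_swaps: "measure_pmf.expectation P swaps = real (card U) * var"
  using stein_identity[of "\<lambda>x. x"] by (simp add: var_def power2_eq_square)

text \<open>Averaging \<open>swaps_eq\<close> yields a second expression for the mean of
  \<open>swaps\<close>, which again contains \<open>var\<close>; equating both and collecting
  \<open>var\<close> gives the formula. Keeping the factor \<open>card U - 1\<close> on the left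
  covers a population of size one.\<close>

lemma var_eq:
  defines "\<mu> \<equiv> real n * real (card A) / real (card U)"
  shows "(real (card U) - 1) * var = (real n - \<mu>) * (real (card A) - \<mu>)"
proof -
  have "real (card U) * var = measure_pmf.expectation P
     (\<lambda>S. (real n - \<mu>) * (real (card A) - \<mu>) - (real n + real (card A) - 2 * \<mu>) * dev S + (dev S)\<^sup>2)"
    unfolding expectation_swaps[symmetric] \<mu>_def by (rule expectation_P_cong) (rule swaps_eq)
  also have "\<dots> = (real n - \<mu>) * (real (card A) - \<mu>) + var"
    by (simp add: expectation_dev var_def)
  finally show ?thesis by (simp add: algebra_simps)
qed

text \<open>The product \<open>a * (N - a)\<close> is at most \<open>N^2 / 4\<close>, attained when
  half of the population lies in \<open>A\<close>. This worst case is the source of the factor 1/2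
  in the confidence bounds.\<close>

lemma var_le:
  "(real (card U) - 1) * var \<le> real n * (real (card U) - real n) / 4"
proof -
  let ?N = "real (card U)" and ?a = "real (card A)"
  have "(?N - 1) * var = (real n * (?N - real n)) * (?a * (?N - ?a)) / ?N\<^sup>2"
    unfolding var_eq using card_U_pos by (simp add: field_simps power2_eq_square)
  also have "\<dots> \<le> (real n * (?N - real n)) * (?N\<^sup>2 / 4) / ?N\<^sup>2"
  proof (intro divide_right_mono mult_left_mono)
    have "0 \<le> (?N - 2 * ?a)\<^sup>2" by simp
    then show "?a * (?N - ?a) \<le> ?N\<^sup>2 / 4" by (simp add: power2_eq_square algebra_simps)
  qed (use n_le in auto)
  finally show ?thesis using card_U_pos by simp
qed

lemma var_nonneg: "0 \<le> var"
  unfolding var_def by simp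

lemma var_le_card_U: "var \<le> (real (card U))\<^sup>2"
proof -
  have "var \<le> measure_pmf.expectation P (\<lambda>_. (real (card U))\<^sup>2)"
    unfolding var_def by (rule expectation_P_mono) (use abs_dev_le in \<open>simp add: abs_le_square_iff[symmetric]\<close>)
  then show ?thesis by simp
qed

text \<open>Jensen's inequality, read off from the nonnegative variance of
  \<open>\<bar>dev\<bar>\<close>.\<close>

lemma expectation_abs_dev: "measure_pmf.expectation P (\<lambda>S. \<bar>dev S\<bar>) \<le> sqrt var"
proof (rule real_le_rsqrt)
  have "0 \<le> measure_pmf.variance P (\<lambda>S. \<bar>dev S\<bar>)"
    by (rule measure_pmf.variance_positive)
  also have "\<dots> = var - (measure_pmf.expectation P (\<lambda>S. \<bar>dev S\<bar>))\<^sup>2"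
    by (subst measure_pmf.variance_eq) (auto simp: var_def)
  finally show "(measure_pmf.expectation P (\<lambda>S. \<bar>dev S\<bar>))\<^sup>2 \<le> var" by simp
qed

lemma chebyshev:
  assumes "0 < c"
  shows "measure_pmf.prob P {S. c \<le> \<bar>dev S\<bar>} \<le> var / c\<^sup>2"
  using measure_pmf.Chebyshev_inequality[of dev P c] assms
  by (simp add: expectation_dev var_def)

text \<open>Write \<open>N = card U\<close>. By \<open>var_eq\<close> the constant term of
  \<open>swaps_eq\<close> is \<open>(N - 1) * var\<close>, so the difference is
  \<open>dev^2 - c * dev - var\<close> with \<open>\<bar>c\<bar> \<le> 2 * N\<close>. As
  \<open>\<bar>dev\<bar> \<le> N\<close>, the random part is at most
  \<open>3 * N * \<bar>dev\<bar>\<close>, and \<open>var \<le> N * sqrt var\<close> raises the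
  constant to 4. Relative to the mean \<open>N * var\<close>, the error is of order
  \<open>1 / sqrt var\<close>.\<close>

lemma expectation_swaps_deviation:
  "measure_pmf.expectation P (\<lambda>S. \<bar>swaps S - real (card U) * var\<bar>) \<le> 4 * real (card U) * sqrt var"
proof -
  let ?N = "real (card U)"
  define \<mu> where "\<mu> = real n * real (card A) / ?N"
  have a: "real (card A) \<le> ?N" using finite_U A_subset by (simp add: card_mono)
  have n: "real n \<le> ?N" using n_le by simp
  have \<mu>: "0 \<le> \<mu>" "\<mu> \<le> real n" "\<mu> \<le> real (card A)"
    using a n card_U_pos mult_right_mono[OF n, of "real (card A)"] mult_left_mono[OF a, of "real n"]
    unfolding \<mu>_def by (simp_all add: divide_le_eq mult.commute)
  have c: "\<bar>real n + real (card A) - 2 * \<mu>\<bar> \<le> 2 * ?N"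
    using a n \<mu> by linarith
  have "\<bar>swaps S - ?N * var\<bar> \<le> 3 * ?N * \<bar>dev S\<bar> + var" if S: "S \<in> samples" for S
  proof -
    have "swaps S - ?N * var = (dev S)\<^sup>2 - (real n + real (card A) - 2 * \<mu>) * dev S - var"
      using var_eq unfolding swaps_eq[OF S] \<mu>_def[symmetric] by (simp add: algebra_simps)
    moreover have "\<bar>(real n + real (card A) - 2 * \<mu>) * dev S\<bar> \<le> 2 * ?N * \<bar>dev S\<bar>"
      unfolding abs_mult by (rule mult_right_mono[OF c]) simp
    moreover have "(dev S)\<^sup>2 \<le> ?N * \<bar>dev S\<bar>"
      using abs_dev_le[OF S] by (metis abs_ge_zero abs_mult_self_eq mult_right_mono power2_eq_square)
    ultimately show ?thesis using var_nonneg zero_le_power2[of "dev S"] by linarith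
  qed
  then have "measure_pmf.expectation P (\<lambda>S. \<bar>swaps S - ?N * var\<bar>) \<le>
      measure_pmf.expectation P (\<lambda>S. 3 * ?N * \<bar>dev S\<bar> + var)"
    by (rule expectation_P_mono)
  also have "\<dots> = 3 * ?N * measure_pmf.expectation P (\<lambda>S. \<bar>dev S\<bar>) + var" by simp
  also have "\<dots> \<le> 3 * ?N * sqrt var + ?N * sqrt var"
  proof (rule add_mono)
    have "sqrt var \<le> ?N" using var_le_card_U card_U_pos by (simp add: real_le_lsqrt var_nonneg)
    then have "sqrt var * sqrt var \<le> ?N * sqrt var" by (rule mult_right_mono) (simp add: var_nonneg)
    then show "var \<le> ?N * sqrt var" by (simp add: var_nonneg)
  qed (use expectation_abs_dev in \<open>simp add: mult_left_mono\<close>)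
  finally show ?thesis by simp
qed

end

section \<open>The central limit theorem for the hypergeometric distribution\<close>

context simple_random_sample
begin

definition charf :: "real \<Rightarrow> complex" where
  "charf s = measure_pmf.expectation P (\<lambda>S. iexp (s * (dev S / sqrt var)))"

lemma norm_charf_le: "norm (charf s) \<le> 1"
proof -
  have "norm (charf s) \<le> measure_pmf.expectation P (\<lambda>S. norm (iexp (s * (dev S / sqrt var))))"
    unfolding charf_def by (rule integral_norm_bound)
  then show ?thesis by simp
qed

text \<open>The sample space is finite, so the expectation is a finite sum and can be differentiated
  term by term.\<close>

lemma charf_has_vector_derivative:
  "(charf has_vector_derivative
      measure_pmf.expectation P (\<lambda>S. (\<i> * (dev S / sqrt var)) * iexp (s * (dev S / sqrt var)))) (at s within B)"
proof -
  have iexp: "((\<lambda>s. iexp (s * c)) has_vector_derivative (\<i> * c) * iexp (s * c)) (at s within B)" for c :: real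
  proof -
    have "((\<lambda>z. exp (\<i> * (z * c))) has_field_derivative (\<i> * c) * exp (\<i> * (of_real s * c))) (at (of_real s))"
      by (rule derivative_eq_intros refl | simp)+
    from has_vector_derivative_real_field[OF this] show ?thesis by simp
  qed
  have "((\<lambda>s. (\<Sum>S\<in>samples. iexp (s * (dev S / sqrt var))) /\<^sub>R real (card samples)) has_vector_derivative
      (\<Sum>S\<in>samples. (\<i> * (dev S / sqrt var)) * iexp (s * (dev S / sqrt var))) /\<^sub>R real (card samples)) (at s within B)"
    by (intro bounded_linear.has_vector_derivative[OF bounded_linear_scaleR_right]
        has_vector_derivative_sum iexp)
  then show ?thesis
    unfolding charf_def[abs_def] expectation_P .
qed

text \<open>Stein's identity for \<open>h x = iexp (s * x / sqrt var)\<close>: a unit step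
  multiplies this \<open>h\<close> by \<open>iexp (s / sqrt var)\<close>, so the difference is a
  constant times \<open>h\<close>.\<close>

lemma charf_deriv_eq:
  assumes "0 < var"
  shows "measure_pmf.expectation P (\<lambda>S. (\<i> * (dev S / sqrt var)) * iexp (s * (dev S / sqrt var))) =
    \<i> * (iexp (s / sqrt var) - 1) / (real (card U) * sqrt var) *
      measure_pmf.expectation P (\<lambda>S. swaps S *\<^sub>R iexp (s * (dev S / sqrt var)))"
proof -
  let ?\<sigma> = "sqrt var" and ?h = "\<lambda>x. iexp (s * (x / sqrt var))"
  have e: "?h (x + 1) - ?h x = (iexp (s / ?\<sigma>) - 1) * ?h x" for x
    by (simp add: add_divide_distrib distrib_left exp_add[symmetric] algebra_simps)
  have "measure_pmf.expectation P (\<lambda>S. (\<i> * (dev S / ?\<sigma>)) * ?h (dev S)) =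
     measure_pmf.expectation P (\<lambda>S. \<i> / ?\<sigma> * (dev S *\<^sub>R ?h (dev S)))"
    by (rule arg_cong[where f = "measure_pmf.expectation P"]) (simp add: fun_eq_iff scaleR_conv_of_real)
  also have "\<dots> = \<i> / ?\<sigma> * measure_pmf.expectation P (\<lambda>S. dev S *\<^sub>R ?h (dev S))"
    by (rule integral_mult_right_zero)
  also have "measure_pmf.expectation P (\<lambda>S. dev S *\<^sub>R ?h (dev S)) =
      measure_pmf.expectation P (\<lambda>S. swaps S *\<^sub>R (?h (dev S + 1) - ?h (dev S))) / real (card U)"
    using card_U_pos by (subst stein_identity[symmetric]) (simp add: scaleR_conv_of_real)
  also have "(\<lambda>S. swaps S *\<^sub>R (?h (dev S + 1) - ?h (dev S))) =
      (\<lambda>S. (iexp (s / ?\<sigma>) - 1) * (swaps S *\<^sub>R ?h (dev S)))"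
    unfolding e by simp
  also have "measure_pmf.expectation P \<dots> = (iexp (s / ?\<sigma>) - 1) * measure_pmf.expectation P (\<lambda>S. swaps S *\<^sub>R ?h (dev S))"
    by (rule integral_mult_right_zero)
  finally show ?thesis by (simp add: mult.commute)
qed

text \<open>The characteristic function almost solves \<open>\<phi>' = - s \<phi>\<close>, the differential equation of the
  standard normal one.\<close>

lemma charf_deriv_bound:
  assumes "0 < var"
  shows "norm (measure_pmf.expectation P (\<lambda>S. (\<i> * (dev S / sqrt var)) * iexp (s * (dev S / sqrt var)))
    + s * charf s) \<le> (4 * \<bar>s\<bar> + s\<^sup>2) / sqrt var"
proof -
  define \<sigma> where "\<sigma> = sqrt var"
  have \<sigma>: "0 < \<sigma>" "var = \<sigma>\<^sup>2" using assms unfolding \<sigma>_def by simp_all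
  let ?N = "real (card U)"
  let ?e = "\<lambda>S. iexp (s * (dev S / \<sigma>))"
  define G where "G = measure_pmf.expectation P (\<lambda>S. swaps S *\<^sub>R ?e S)"
  have "G - (?N * var) *\<^sub>R charf s = measure_pmf.expectation P (\<lambda>S. (swaps S - ?N * var) *\<^sub>R ?e S)"
    unfolding G_def charf_def \<sigma>_def by (simp add: scaleR_left_diff_distrib)
  also have "norm \<dots> \<le> measure_pmf.expectation P (\<lambda>S. norm ((swaps S - ?N * var) *\<^sub>R ?e S))"
    by (rule integral_norm_bound)
  also have "\<dots> \<le> 4 * ?N * \<sigma>"
    using expectation_swaps_deviation unfolding \<sigma>_def by simp
  finally have G: "norm (G - (?N * var) *\<^sub>R charf s) \<le> 4 * ?N * \<sigma>" .
  have u1: "norm (iexp (s / \<sigma>) - 1) \<le> \<bar>s\<bar> / \<sigma>"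
    using iexp_approx1[of "s / \<sigma>" 0] \<sigma> by simp
  have u2: "norm (iexp (s / \<sigma>) - 1 - \<i> * (s / \<sigma>)) \<le> s\<^sup>2 / (2 * \<sigma>\<^sup>2)"
    using iexp_approx1[of "s / \<sigma>" 1] \<sigma> by (simp add: power2_eq_square abs_mult_self_eq algebra_simps)
  \<comment> \<open>The first summand is the error of replacing \<open>swaps\<close> by its mean.
    The second is a Taylor remainder: \<open>N * var / (N * \<sigma>) = \<sigma>\<close>, and the
    linear term of \<open>iexp (s / \<sigma>) - 1\<close> contributes \<open>- s * charf s\<close>,
    which cancels the added \<open>s * charf s\<close>.\<close>
  have eq: "\<i> * (iexp (s / \<sigma>) - 1) / (?N * \<sigma>) * G + s * charf s =
     \<i> * (iexp (s / \<sigma>) - 1) / (?N * \<sigma>) * (G - (?N * var) *\<^sub>R charf s) +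
     \<i> * \<sigma> * (iexp (s / \<sigma>) - 1 - \<i> * (s / \<sigma>)) * charf s"
    using \<sigma> card_U_pos by (simp add: field_simps scaleR_conv_of_real power2_eq_square)
  have "norm (\<i> * (iexp (s / \<sigma>) - 1) / (?N * \<sigma>) * (G - (?N * var) *\<^sub>R charf s)) \<le>
      (\<bar>s\<bar> / \<sigma>) / (?N * \<sigma>) * (4 * ?N * \<sigma>)"
  proof -
    have "norm (\<i> * (iexp (s / \<sigma>) - 1) / (?N * \<sigma>)) \<le> (\<bar>s\<bar> / \<sigma>) / (?N * \<sigma>)"
      unfolding norm_divide norm_mult using divide_right_mono[OF u1, of "?N * \<sigma>"] \<sigma>
      by (simp only: norm_of_real norm_ii mult_1_left) simp
    then show ?thesis
      unfolding norm_mult[of _ "G - _"] by (rule mult_mono[OF _ G]) (use \<sigma> in auto)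
  qed
  also have "\<dots> = 4 * \<bar>s\<bar> / \<sigma>"
    using \<sigma> card_U_pos by (simp add: field_simps)
  finally have 1: "norm (\<i> * (iexp (s / \<sigma>) - 1) / (?N * \<sigma>) * (G - (?N * var) *\<^sub>R charf s)) \<le> 4 * \<bar>s\<bar> / \<sigma>" .
  have "norm (\<i> * \<sigma> * (iexp (s / \<sigma>) - 1 - \<i> * (s / \<sigma>)) * charf s) \<le> (\<sigma> * (s\<^sup>2 / (2 * \<sigma>\<^sup>2))) * 1"
    unfolding norm_mult[of _ "charf s"]
    by (intro mult_mono norm_charf_le)
       (use mult_left_mono[OF u2, of \<sigma>] \<sigma> in \<open>simp_all add: norm_mult\<close>)
  also have "\<dots> \<le> s\<^sup>2 / \<sigma>"
    using \<sigma> by (simp add: field_simps power2_eq_square)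
  finally have 2: "norm (\<i> * \<sigma> * (iexp (s / \<sigma>) - 1 - \<i> * (s / \<sigma>)) * charf s) \<le> s\<^sup>2 / \<sigma>" .
  have "norm (measure_pmf.expectation P (\<lambda>S. (\<i> * (dev S / \<sigma>)) * ?e S) + s * charf s) \<le> 4 * \<bar>s\<bar> / \<sigma> + s\<^sup>2 / \<sigma>"
    unfolding charf_deriv_eq[OF assms, folded \<sigma>_def] G_def[symmetric] eq
    by (rule order_trans[OF norm_triangle_ineq add_mono[OF 1 2]])
  then show ?thesis by (simp only: \<sigma>_def add_divide_distrib)
qed

text \<open>The integrating factor \<open>exp (s^2 / 2)\<close> turns
  \<open>charf' + s * charf\<close> into the derivative of \<open>H\<close>. A small derivative
  keeps \<open>H t\<close> close to \<open>H 0 = 1\<close>, and multiplying back by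
  \<open>exp (- t^2 / 2) \<le> 1\<close> does not enlarge the error.\<close>

lemma charf_approx:
  assumes "0 < var"
  shows "norm (charf t - exp (- (t\<^sup>2) / 2)) \<le> (4 * \<bar>t\<bar> + t\<^sup>2) * exp (t\<^sup>2 / 2) * \<bar>t\<bar> / sqrt var"
proof -
  let ?d = "\<lambda>s. measure_pmf.expectation P (\<lambda>S. (\<i> * (dev S / sqrt var)) * iexp (s * (dev S / sqrt var)))"
  define H where "H s = exp (s\<^sup>2 / 2) *\<^sub>R charf s" for s :: real
  define K where "K = (4 * \<bar>t\<bar> + t\<^sup>2) * exp (t\<^sup>2 / 2) / sqrt var"
  \<comment> \<open>The symmetric interval treats both signs of \<open>t\<close> at once;
    \<open>K\<close> bounds the derivative uniformly on it.\<close>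
  have "norm (H t - H 0) \<le> K * norm (t - 0)"
  proof (rule differentiable_bound[where S = "{- \<bar>t\<bar>..\<bar>t\<bar>}" and f' = "\<lambda>s x. x *\<^sub>R (exp (s\<^sup>2 / 2) *\<^sub>R (?d s + s * charf s))"])
    fix s assume s: "s \<in> {- \<bar>t\<bar>..\<bar>t\<bar>}"
    have "(H has_vector_derivative (exp (s\<^sup>2 / 2) *\<^sub>R (?d s + s * charf s))) (at s within {- \<bar>t\<bar>..\<bar>t\<bar>})"
      unfolding H_def[abs_def]
      by (rule derivative_eq_intros charf_has_vector_derivative refl | simp)+
         (simp add: scaleR_conv_of_real algebra_simps)
    then show "(H has_derivative (\<lambda>x. x *\<^sub>R (exp (s\<^sup>2 / 2) *\<^sub>R (?d s + s * charf s)))) (at s within {- \<bar>t\<bar>..\<bar>t\<bar>})"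
      by (simp add: has_vector_derivative_def)
    have st: "\<bar>s\<bar> \<le> \<bar>t\<bar>" "s\<^sup>2 \<le> t\<^sup>2" using s by (auto simp: abs_le_square_iff[symmetric])
    have "norm (exp (s\<^sup>2 / 2) *\<^sub>R (?d s + s * charf s)) \<le> exp (t\<^sup>2 / 2) * ((4 * \<bar>t\<bar> + t\<^sup>2) / sqrt var)"
      unfolding norm_scaleR
      by (intro mult_mono order_trans[OF charf_deriv_bound[OF assms]])
         (use st assms in \<open>auto intro!: divide_right_mono add_mono\<close>)
    then have *: "norm (exp (s\<^sup>2 / 2) *\<^sub>R (?d s + s * charf s)) \<le> K"
      unfolding K_def by (simp add: mult.commute)
    show "onorm (\<lambda>x. x *\<^sub>R (exp (s\<^sup>2 / 2) *\<^sub>R (?d s + s * charf s))) \<le> K"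
    proof (rule onorm_le)
      fix x show "norm (x *\<^sub>R (exp (s\<^sup>2 / 2) *\<^sub>R (?d s + s * charf s))) \<le> K * norm x"
        unfolding norm_scaleR[of x] using mult_right_mono[OF *, of "\<bar>x\<bar>"] by (simp only: mult.commute real_norm_def abs_ge_zero)
    qed
  qed auto
  moreover have "H 0 = 1" by (simp add: H_def charf_def)
  ultimately have "norm (H t - 1) \<le> K * \<bar>t\<bar>" by simp
  have "charf t - exp (- (t\<^sup>2) / 2) = exp (- (t\<^sup>2) / 2) *\<^sub>R (H t - 1)"
    unfolding H_def by (simp add: scaleR_conv_of_real algebra_simps exp_minus exp_of_real[symmetric])
  then have "norm (charf t - exp (- (t\<^sup>2) / 2)) \<le> norm (H t - 1)"
    using mult_left_le_one_le[of "norm (H t - 1)" "exp (- (t\<^sup>2) / 2)"] by simp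
  then show ?thesis using \<open>norm (H t - 1) \<le> K * \<bar>t\<bar>\<close> unfolding K_def by simp
qed

end

text \<open>For fixed \<open>t\<close> the error in \<open>charf_approx\<close> is a constant over
  \<open>sqrt var\<close>, so the characteristic functions converge pointwise and Levy's continuity
  theorem applies. Only the variance has to grow; no limit of the sampling fraction is
  assumed.\<close>

theorem hypergeometric_clt:
  fixes U A :: "nat \<Rightarrow> 'a set" and n :: "nat \<Rightarrow> nat"
  assumes srs: "\<And>k. simple_random_sample (U k) (A k) (n k)"
    and lim: "filterlim (\<lambda>k. simple_random_sample.var (U k) (A k) (n k)) at_top sequentially"
  shows "weak_conv_m (\<lambda>k. distr (simple_random_sample.P (U k) (n k)) borel
      (\<lambda>S. simple_random_sample.dev (U k) (A k) (n k) S / sqrt (simple_random_sample.var (U k) (A k) (n k))))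
    std_normal_distribution"
proof (rule levy_continuity)
  interpret srs: simple_random_sample "U k" "A k" "n k" for k by (rule srs)
  show "real_distribution (distr (srs.P k) borel (\<lambda>S. srs.dev k S / sqrt (srs.var k)))" for k
    by (rule prob_space.real_distribution_distr) (simp_all add: measure_pmf.prob_space_axioms)
  show "real_distribution std_normal_distribution" by (rule real_dist_normal_dist)
  fix t
  have char: "char (distr (srs.P k) borel (\<lambda>S. srs.dev k S / sqrt (srs.var k))) t = srs.charf k t" for k
    unfolding char_def srs.charf_def by (subst integral_distr) auto
  let ?C = "(4 * \<bar>t\<bar> + t\<^sup>2) * exp (t\<^sup>2 / 2) * \<bar>t\<bar>"
  have "(\<lambda>k. srs.charf k t - exp (- (t\<^sup>2) / 2)) \<longlonglongrightarrow> 0"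
  proof (rule Lim_null_comparison)
    show "\<forall>\<^sub>F k in sequentially. norm (srs.charf k t - exp (- (t\<^sup>2) / 2)) \<le> ?C / sqrt (srs.var k)"
      using filterlim_at_top_dense[THEN iffD1, OF lim, rule_format, of 0]
      by eventually_elim (rule srs.charf_approx)
    show "(\<lambda>k. ?C / sqrt (srs.var k)) \<longlonglongrightarrow> 0"
      by (intro tendsto_divide_0[OF tendsto_const] filterlim_at_top_imp_at_infinity
          filterlim_compose[OF sqrt_at_top lim])
  qed
  then show "(\<lambda>k. char (distr (srs.P k) borel (\<lambda>S. srs.dev k S / sqrt (srs.var k))) t)
      \<longlonglongrightarrow> char std_normal_distribution t"
    unfolding char char_std_normal_distribution by (simp add: LIM_zero_iff)
qed

section \<open>Tails of the hypergeometric distribution\<close>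

abbreviation Phi :: "real \<Rightarrow> real" where
  "Phi \<equiv> cdf std_normal_distribution"

text \<open>The law has a Lebesgue density, hence no atoms. Weak convergence therefore gives
  convergence of distribution functions at every point.\<close>

lemma isCont_Phi: "isCont Phi x"
proof -
  interpret real_distribution std_normal_distribution by (rule real_dist_normal_dist)
  have "emeasure std_normal_distribution {x} = 0"
    by (subst emeasure_density) (auto simp: nn_integral_indicator_singleton' AE_lborel_singleton intro!: nn_integral_0_iff_AE[THEN iffD2])
  then show ?thesis unfolding isCont_cdf measure_def by simp
qed

text \<open>The law is invariant under negation and has no atom at 0, so both half-lines carry the
  same mass.\<close>

lemma Phi_0: "Phi 0 = 1 / 2"
proof -
  interpret real_distribution std_normal_distribution by (rule real_dist_normal_dist)
  have sym: "distr std_normal_distribution borel uminus = std_normal_distribution"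
  proof -
    have "distributed std_normal_distribution lborel (\<lambda>x. x) std_normal_density"
      unfolding distributed_def by (auto simp: distr_id2)
    from normal_density_affine[OF this, of "-1" 0]
    have "distr std_normal_distribution lborel uminus = std_normal_distribution"
      by (simp add: distributed_def)
    moreover have "distr std_normal_distribution borel uminus = distr std_normal_distribution lborel uminus"
      by (rule distr_cong) auto
    ultimately show ?thesis by simp
  qed
  have "measure std_normal_distribution {..0} = measure (distr std_normal_distribution borel uminus) {..0}"
    by (simp add: sym)
  also have "\<dots> = measure std_normal_distribution {0..}"
    by (subst measure_distr) (auto intro!: arg_cong[where f = "measure std_normal_distribution"])
  also have "\<dots> = measure std_normal_distribution ({0} \<union> {0<..})"
    by (rule arg_cong[where f = "measure std_normal_distribution"]) auto
  also have "\<dots> = measure std_normal_distribution {0<..}"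
    using isCont_Phi[of 0] by (subst finite_measure_Union) (auto simp: isCont_cdf)
  also have "\<dots> = 1 - measure std_normal_distribution {..0}"
    using prob_compl[of "{..0}"] by (simp add: Compl_eq_Diff_UNIV[symmetric])
  finally show ?thesis by (simp add: cdf_def2)
qed

text \<open>These two facts make the real \<open>Inf\<close> in \<open>quantile\<close> a genuine
  infimum.\<close>

lemma quantile_set_nonempty_bdd_below:
  assumes "0 < q" "q < 1"
  shows "{x. q \<le> Phi x} \<noteq> {}" "bdd_below {x. q \<le> Phi x}"
proof -
  interpret real_distribution std_normal_distribution by (rule real_dist_normal_dist)
  have "eventually (\<lambda>x. q < Phi x) at_top"
    using order_tendstoD(1)[OF cdf_lim_at_top_prob \<open>q < 1\<close>] .
  then show "{x. q \<le> Phi x} \<noteq> {}"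
    by (auto simp: eventually_at_top_linorder intro: less_imp_le)
  have "eventually (\<lambda>x. Phi x < q) at_bot"
    using order_tendstoD(2)[OF cdf_lim_at_bot \<open>0 < q\<close>] .
  then obtain b where "\<forall>x\<le>b. Phi x < q" by (auto simp: eventually_at_bot_linorder)
  then show "bdd_below {x. q \<le> Phi x}"
    by (intro bdd_belowI[of _ b]) (use linear not_less in blast)
qed

text \<open>Every point to the right of the infimum satisfies the inequality, and continuity carries
  it to the infimum itself.\<close>

lemma Phi_z_quantile:
  assumes "0 < q" "q < 1"
  shows "q \<le> Phi (z_quantile q)"
proof (rule tendsto_lowerbound)
  show "(Phi \<longlongrightarrow> Phi (z_quantile q)) (at_right (z_quantile q))"
    using isCont_Phi[of "z_quantile q"] unfolding isCont_def by (rule filterlim_mono) (auto simp: at_le)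
  interpret real_distribution std_normal_distribution by (rule real_dist_normal_dist)
  have "q \<le> Phi x" if x: "z_quantile q < x" for x
  proof -
    obtain y where "q \<le> Phi y" "y < x"
      using x quantile_set_nonempty_bdd_below[OF assms] unfolding z_quantile_def quantile_def by (auto simp: cInf_less_iff)
    then show ?thesis using cdf_nondecreasing[of y x] by simp
  qed
  then show "\<forall>\<^sub>F x in at_right (z_quantile q). q \<le> Phi x"
    by (auto simp: eventually_at_filter)
qed simp

text \<open>The tail bounds require a positive threshold. This covers the levels
  \<open>1 - \<alpha>\<close> with \<open>\<alpha> < 1/2\<close> and \<open>1 - \<alpha> / 2\<close>
  with \<open>\<alpha> < 1\<close>.\<close>

lemma z_quantile_pos:
  assumes "1 / 2 < q" "q < 1"
  shows "0 < z_quantile q"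
proof (rule ccontr)
  interpret real_distribution std_normal_distribution by (rule real_dist_normal_dist)
  assume "\<not> 0 < z_quantile q"
  then have "Phi (z_quantile q) \<le> Phi 0" by (intro cdf_nondecreasing) simp
  then show False using Phi_z_quantile[of q] assms Phi_0 by simp
qed

text \<open>By \<open>var_le\<close>, \<open>\<kappa> / 2\<close> bounds the standard deviation up
  to the factor \<open>sqrt (N / (N - 1))\<close> for population size \<open>N\<close>, so the
  threshold is asymptotically at least \<open>z\<close> standard deviations. No growth of the
  variance is assumed: it is derived along a subsequence that violates the claim.\<close>

lemma hypergeometric_upper_tail:
  fixes U A :: "nat \<Rightarrow> 'a set" and n :: "nat \<Rightarrow> nat" and z \<epsilon> :: real
  defines "\<kappa> \<equiv> \<lambda>k. sqrt (real (n k) * (real (card (U k)) - real (n k)) / real (card (U k)))"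
  assumes srs: "\<And>k. simple_random_sample (U k) (A k) (n k)"
    and regime: "filterlim (\<lambda>k. min (n k) (card (U k) - n k)) at_top sequentially"
    and "0 < z" "0 < \<epsilon>"
  shows "\<forall>\<^sub>F k in sequentially. measure_pmf.prob (simple_random_sample.P (U k) (n k))
    {S. z / 2 * \<kappa> k < simple_random_sample.dev (U k) (A k) (n k) S} < 1 - Phi z + \<epsilon>"
proof (rule ccontr)
  interpret srs: simple_random_sample "U k" "A k" "n k" for k by (rule srs)
  interpret N: real_distribution std_normal_distribution by (rule real_dist_normal_dist)
  let ?p = "\<lambda>k. measure_pmf.prob (srs.P k) {S. z / 2 * \<kappa> k < srs.dev k S}"
  have n_lim: "filterlim (\<lambda>k. real (min (n k) (card (U k) - n k))) at_top sequentially"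
    by (rule filterlim_compose[OF filterlim_real_sequentially regime])
  have card_lim: "filterlim (\<lambda>k. real (card (U k))) at_top sequentially"
    by (rule filterlim_at_top_mono[OF n_lim]) (auto intro!: always_eventually simp: min_def)
  have \<kappa>_sq: "(\<kappa> k)\<^sup>2 = real (n k) * (real (card (U k)) - real (n k)) / real (card (U k))" for k
    unfolding \<kappa>_def using srs.n_le[of k] by (simp add: real_sqrt_pow2)
  have \<kappa>_nonneg: "0 \<le> \<kappa> k" for k
    unfolding \<kappa>_def using srs.n_le[of k] by simp
  have \<kappa>_lim: "filterlim (\<lambda>k. (\<kappa> k)\<^sup>2) at_top sequentially"
  proof (rule filterlim_at_top_mono)
    show "filterlim (\<lambda>k. (1 / 2) * real (min (n k) (card (U k) - n k))) at_top sequentially"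
      by (rule filterlim_tendsto_pos_mult_at_top[OF tendsto_const _ n_lim]) simp
    \<comment> \<open>The product \<open>a * (N - a)\<close> is the minimum times the maximum of its
      factors, and the maximum is at least \<open>N / 2\<close>.\<close>
    have "(1 / 2) * real (min a (N - a)) \<le> real a * (real N - real a) / real N" if "a \<le> N" "0 < real N" for a N :: nat
    proof -
      have "min (real a) (real N - real a) * (real N / 2) \<le> min (real a) (real N - real a) * max (real a) (real N - real a)"
        by (rule mult_left_mono) (use that in \<open>auto simp: max_def\<close>)
      also have "\<dots> = real a * (real N - real a)"
        by (simp add: min_def max_def)
      finally have "min (real a) (real N - real a) / 2 \<le> real a * (real N - real a) / real N"
        using that by (simp add: field_simps)
      moreover have "real (min a (N - a)) = min (real a) (real N - real a)"
        using that by (simp add: of_nat_min of_nat_diff)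
      ultimately show ?thesis by simp
    qed
    then show "\<forall>\<^sub>F k in sequentially. (1 / 2) * real (min (n k) (card (U k) - n k)) \<le> (\<kappa> k)\<^sup>2"
      unfolding \<kappa>_sq using srs.n_le srs.card_U_pos by (intro always_eventually) blast
  qed
  assume "\<not> (\<forall>\<^sub>F k in sequentially. ?p k < 1 - Phi z + \<epsilon>)"
  then have "\<exists>\<^sub>\<infinity>k. 1 - Phi z + \<epsilon> \<le> ?p k"
    by (simp add: not_eventually frequently_cofinite cofinite_eq_sequentially not_less)
  then have "infinite {k. 1 - Phi z + \<epsilon> \<le> ?p k}" by (simp add: frequently_cofinite)
  from infinite_enumerate[OF this] obtain r :: "nat \<Rightarrow> nat"
    where r: "strict_mono r" and "\<forall>j. r j \<in> {k. 1 - Phi z + \<epsilon> \<le> ?p k}" by blast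
  then have large: "1 - Phi z + \<epsilon> \<le> ?p (r j)" for j by simp
  have sub: "filterlim (\<lambda>j. g (r j)) F sequentially" if "filterlim g F sequentially" for g :: "nat \<Rightarrow> real" and F
    using filterlim_compose[OF that filterlim_subseq[OF r]] .

  \<comment> \<open>Chebyshev's inequality: a tail of mass at least \<open>\<epsilon>\<close> needs a variance of order \<open>\<kappa>\<^sup>2\<close>.\<close>
  have "\<forall>\<^sub>F j in sequentially. \<epsilon> * (z\<^sup>2 / 4) * (\<kappa> (r j))\<^sup>2 \<le> srs.var (r j)"
    using filterlim_at_top_dense[THEN iffD1, OF sub[OF \<kappa>_lim], rule_format, of 0]
  proof eventually_elim
    case (elim j)
    have \<kappa>: "0 < \<kappa> (r j)" using elim \<kappa>_nonneg[of "r j"] by (auto simp: less_le)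
    have "\<epsilon> \<le> ?p (r j)" using large[of j] N.cdf_bounded_prob[of z] by linarith
    also have "\<dots> \<le> measure_pmf.prob (srs.P (r j)) {S. z / 2 * \<kappa> (r j) \<le> \<bar>srs.dev (r j) S\<bar>}"
      by (rule measure_pmf.finite_measure_mono) auto
    also have "\<dots> \<le> srs.var (r j) / (z / 2 * \<kappa> (r j))\<^sup>2"
      by (rule srs.chebyshev) (use \<open>0 < z\<close> \<kappa> in simp)
    finally show ?case using \<open>0 < z\<close> \<kappa> by (simp add: field_simps power2_eq_square)
  qed
  then have var_lim: "filterlim (\<lambda>j. srs.var (r j)) at_top sequentially"
    by (rule filterlim_at_top_mono[rotated])
       (rule filterlim_tendsto_pos_mult_at_top[OF tendsto_const _ sub[OF \<kappa>_lim]], use \<open>0 < z\<close> \<open>0 < \<epsilon>\<close> in simp)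
  have clt: "weak_conv_m (\<lambda>j. distr (srs.P (r j)) borel (\<lambda>S. srs.dev (r j) S / sqrt (srs.var (r j)))) std_normal_distribution"
    by (rule hypergeometric_clt[OF srs var_lim])

  \<comment> \<open>A point \<open>y\<close> slightly below \<open>z\<close> leaves room for the
    factor \<open>N / (N - 1)\<close> in the variance bound, and by continuity costs at most
    \<open>\<epsilon> / 2\<close> in \<open>Phi\<close>.\<close>
  have "\<forall>\<^sub>F y in at_left z. Phi z - \<epsilon> / 2 < Phi y"
    using order_tendstoD(1)[of Phi "Phi z" "at z" "Phi z - \<epsilon> / 2"] isCont_Phi[of z] \<open>0 < \<epsilon>\<close>
    by (auto simp: isCont_def eventually_at_split)
  moreover have "\<forall>\<^sub>F y in at_left z. 0 < y"
    using \<open>0 < z\<close> by (rule order_tendstoD[OF tendsto_ident_at])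
  moreover have "\<forall>\<^sub>F y in at_left z. y < z"
    by (simp add: eventually_at_filter)
  ultimately have "\<forall>\<^sub>F y in at_left z. Phi z - \<epsilon> / 2 < Phi y \<and> 0 < y \<and> y < z"
    by eventually_elim simp
  then obtain y where y: "Phi z - \<epsilon> / 2 < Phi y" "0 < y" "y < z"
    using eventually_happens'[OF trivial_limit_at_left_real] by blast
  have "(\<lambda>j. cdf (distr (srs.P (r j)) borel (\<lambda>S. srs.dev (r j) S / sqrt (srs.var (r j)))) y) \<longlonglongrightarrow> Phi y"
    using clt isCont_Phi unfolding weak_conv_m_def weak_conv_def by blast
  then have "\<forall>\<^sub>F j in sequentially. Phi y - \<epsilon> / 2 <
      cdf (distr (srs.P (r j)) borel (\<lambda>S. srs.dev (r j) S / sqrt (srs.var (r j)))) y"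
    by (rule order_tendstoD) (use \<open>0 < \<epsilon>\<close> in simp)
  moreover have "\<forall>\<^sub>F j in sequentially. 0 < srs.var (r j)"
    using var_lim by (simp add: filterlim_at_top_dense)
  moreover have "\<forall>\<^sub>F j in sequentially. y * sqrt (srs.var (r j)) \<le> z / 2 * \<kappa> (r j)"
  proof -
    \<comment> \<open>The bound on \<open>N\<close> is the solution of
      \<open>y^2 * N \<le> z^2 * (N - 1)\<close>, which is positive and finite because
      \<open>0 < y < z\<close>.\<close>
    have "z\<^sup>2 / (z\<^sup>2 - y\<^sup>2) \<le> N \<Longrightarrow> y\<^sup>2 * N \<le> z\<^sup>2 * (N - 1)" for N
      using y by (simp add: field_simps power_strict_mono)
    then have "\<forall>\<^sub>F j in sequentially. y\<^sup>2 * real (card (U (r j))) \<le> z\<^sup>2 * (real (card (U (r j))) - 1)"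
      using sub[OF card_lim] by (auto simp: filterlim_at_top elim!: allE[of _ "z\<^sup>2 / (z\<^sup>2 - y\<^sup>2)"] eventually_mono)
    moreover have "\<forall>\<^sub>F j in sequentially. 1 < real (card (U (r j)))"
      using sub[OF card_lim] by (simp only: filterlim_at_top_dense)
    ultimately show ?thesis
    proof eventually_elim
      case (elim j)
      let ?N = "real (card (U (r j)))" and ?v = "srs.var (r j)"
      have "(?N - 1) * ?v \<le> ?N * (\<kappa> (r j))\<^sup>2 / 4"
        using srs.var_le[of "r j"] elim unfolding \<kappa>_sq by simp
      then have "y\<^sup>2 * ((?N - 1) * ?v) \<le> (y\<^sup>2 * ?N) * ((\<kappa> (r j))\<^sup>2 / 4)"
        using mult_left_mono[of _ _ "y\<^sup>2"] by fastforce
      also have "\<dots> \<le> (z\<^sup>2 * (?N - 1)) * ((\<kappa> (r j))\<^sup>2 / 4)"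
        by (rule mult_right_mono[OF elim(1)]) simp
      finally have "(?N - 1) * (y\<^sup>2 * ?v) \<le> (?N - 1) * (z\<^sup>2 * (\<kappa> (r j))\<^sup>2 / 4)"
        by (simp add: algebra_simps)
      then have "y\<^sup>2 * ?v \<le> z\<^sup>2 * (\<kappa> (r j))\<^sup>2 / 4"
        using elim by simp
      then have "(y * sqrt ?v)\<^sup>2 \<le> (z / 2 * \<kappa> (r j))\<^sup>2"
        by (simp add: power_mult_distrib power_divide srs.var_nonneg)
      then show ?case
        by (rule power2_le_imp_le) (use \<open>0 < z\<close> \<kappa>_nonneg in simp)
    qed
  qed
  \<comment> \<open>The tail is at most one minus the distribution function at \<open>y\<close>,
    hence below \<open>1 - Phi y + \<epsilon> / 2\<close> and so below
    \<open>1 - Phi z + \<epsilon>\<close>, against the choice of the subsequence.\<close>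
  ultimately have "\<forall>\<^sub>F j in sequentially. False"
  proof eventually_elim
    case (elim j)
    let ?v = "srs.var (r j)"
    have "?p (r j) \<le> measure_pmf.prob (srs.P (r j)) (- {S. srs.dev (r j) S / sqrt ?v \<le> y})"
      by (rule measure_pmf.finite_measure_mono) (use elim in \<open>auto simp: field_simps\<close>)
    also have "\<dots> = 1 - measure_pmf.prob (srs.P (r j)) {S. srs.dev (r j) S / sqrt ?v \<le> y}"
      using measure_pmf.prob_compl[of "{S. srs.dev (r j) S / sqrt ?v \<le> y}" "srs.P (r j)"]
      by (simp add: Compl_eq_Diff_UNIV)
    also have "measure_pmf.prob (srs.P (r j)) {S. srs.dev (r j) S / sqrt ?v \<le> y} =
        cdf (distr (srs.P (r j)) borel (\<lambda>S. srs.dev (r j) S / sqrt ?v)) y"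
      unfolding cdf_def by (subst measure_distr) (auto simp: vimage_def)
    finally show False using large[of j] elim y by linarith
  qed
  then show False by simp
qed

section \<open>Differences in means under sampling without replacement\<close>

text \<open>The target of \<open>X\<close> carries the discrete sigma-algebra, so every predicate of
  the assignment is an event, however irregular the potential outcomes are.\<close>

lemma sampled_measurable:
  assumes "sampled_without_replacement M N N1 X"
  shows "{\<omega> \<in> space M. Q (X \<omega>)} \<in> sets M"
proof -
  have X: "X \<in> M \<rightarrow>\<^sub>M count_space (assignments N)"
    using assms by (simp add: sampled_without_replacement_def)
  have "{\<omega> \<in> space M. Q (X \<omega>)} = X -` {x \<in> assignments N. Q x} \<inter> space M"
    using measurable_space[OF X] by auto
  then show ?thesis using measurable_sets[OF X, of "{x \<in> assignments N. Q x}"] by simp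
qed

text \<open>Extensionality makes an assignment recoverable from its treated set; the inverse is the
  indicator restricted to the units.\<close>

lemma bij_betw_arm:
  "bij_betw (\<lambda>x. arm N x 1) {x \<in> assignments N. card (arm N x 1) = k} {S. S \<subseteq> {1..N} \<and> card S = k}"
proof (rule bij_betw_byWitness[where f' = "\<lambda>S. \<lambda>i\<in>{1..N}. of_bool (i \<in> S)"])
  have "(\<lambda>i\<in>{1..N}. of_bool (i \<in> arm N x 1)) = x" if "x \<in> assignments N" for x
    using that by (force simp: assignments_def arm_def PiE_iff extensional_def)
  then show "\<forall>x\<in>{x \<in> assignments N. card (arm N x 1) = k}. (\<lambda>i\<in>{1..N}. of_bool (i \<in> arm N x 1)) = x"
    by blast
  have arm: "arm N (\<lambda>i\<in>{1..N}. of_bool (i \<in> S)) 1 = S" if "S \<subseteq> {1..N}" for S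
    using that by (auto simp: arm_def)
  then show "\<forall>S\<in>{S. S \<subseteq> {1..N} \<and> card S = k}. arm N (\<lambda>i\<in>{1..N}. of_bool (i \<in> S)) 1 = S"
    by blast
  show "(\<lambda>S. \<lambda>i\<in>{1..N}. of_bool (i \<in> S)) ` {S. S \<subseteq> {1..N} \<and> card S = k} \<subseteq>
      {x \<in> assignments N. card (arm N x 1) = k}"
    using arm by (auto simp: assignments_def)
qed (auto simp: arm_def)

text \<open>Both probabilities are ratios of cardinalities, and the bijection with treated sets
  preserves numerator and denominator. The predicates only have to agree on assignments with exactly
  \<open>k\<close> treated units.\<close>

lemma sampled_prob:
  assumes X: "sampled_without_replacement M N k X" and "k \<le> N"
    and Q: "\<And>x. x \<in> assignments N \<Longrightarrow> card (arm N x 1) = k \<Longrightarrow> Q x \<longleftrightarrow> R (arm N x 1)"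
  shows "measure M {\<omega> \<in> space M. Q (X \<omega>)} =
    measure_pmf.prob (pmf_of_set {S. S \<subseteq> {1..N} \<and> card S = k}) {S. R S}"
proof -
  let ?C = "count_space (assignments N)"
  let ?E = "{x \<in> assignments N. card (arm N x 1) = k}" and ?F = "{S. S \<subseteq> {1..N} \<and> card S = k}"
  have Xm: "X \<in> M \<rightarrow>\<^sub>M ?C"
    and distr: "distr M ?C X = uniform_measure ?C ?E"
    using X by (simp_all add: sampled_without_replacement_def)
  have finE: "finite ?E"
    by (rule finite_subset[of _ "assignments N"]) (auto simp: assignments_def intro: finite_PiE)
  have F: "finite ?F" "?F \<noteq> {}"
    using obtain_subset_with_card_n[of k "{1..N}"] \<open>k \<le> N\<close> by (auto simp del: atLeastAtMost_iff)
  have card_eq: "card ?E = card ?F" by (rule bij_betw_same_card[OF bij_betw_arm])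
  then have "?E \<noteq> {}" using F by (metis card.empty card_0_eq)
  have card_sub: "card (?E \<inter> {x. Q x}) = card (?F \<inter> {S. R S})"
  proof (rule bij_betw_same_card[OF bij_betw_subset[OF bij_betw_arm[of N k]]])
    have img: "?F = (\<lambda>x. arm N x 1) ` ?E" using bij_betw_arm by (rule bij_betw_imp_surj_on[symmetric])
    show "(\<lambda>x. arm N x 1) ` (?E \<inter> {x. Q x}) = ?F \<inter> {S. R S}"
      unfolding img using Q by blast
  qed auto
  have "{\<omega> \<in> space M. Q (X \<omega>)} = X -` {x \<in> assignments N. Q x} \<inter> space M"
    using measurable_space[OF Xm] by auto
  then have "measure M {\<omega> \<in> space M. Q (X \<omega>)} = measure (distr M ?C X) {x \<in> assignments N. Q x}"
    by (simp add: measure_distr[OF Xm])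
  also have "\<dots> = measure ?C (?E \<inter> {x \<in> assignments N. Q x}) / measure ?C ?E"
    unfolding distr
    by (rule measure_uniform_measure) (use finE \<open>?E \<noteq> {}\<close> in \<open>auto simp: emeasure_count_space\<close>)
  also have "?E \<inter> {x \<in> assignments N. Q x} = ?E \<inter> {x. Q x}" by auto
  also have "measure ?C (?E \<inter> {x. Q x}) / measure ?C ?E = card (?E \<inter> {x. Q x}) / card ?E"
    using finE by (subst (1 2) measure_count_space) auto
  also have "\<dots> = measure_pmf.prob (pmf_of_set ?F) {S. R S}"
    unfolding card_eq card_sub by (rule measure_pmf_of_set[OF F(2,1), symmetric])
  finally show ?thesis .
qed

section \<open>The difference in means for a fixed assignment\<close>

context
  fixes N N0 N1 :: nat and x :: "nat \<Rightarrow> nat"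
  assumes size: "N = N0 + N1" and pos: "0 < N0" "0 < N1"
    and x: "x \<in> assignments N" "card (arm N x 1) = N1"
begin

lemma arm_control: "arm N x 0 = {1..N} - arm N x 1"
  using x(1) by (fastforce simp: arm_def assignments_def PiE_iff)

lemma card_arm_control: "card (arm N x 0) = N0"
  unfolding arm_control using x(2) size by (subst card_Diff_subset) (auto simp: arm_def)

text \<open>If \<open>k\<close> of the \<open>a\<close> units with value 1 are treated, the
  difference is \<open>k / N1 - (a - k) / N0\<close>. Over the common denominator the numerator is
  \<open>N * k - N1 * a\<close>, which is \<open>N\<close> times the centred count.\<close>

lemma diff_in_means_binary:
  assumes v: "\<And>i. i \<in> {1..N} \<Longrightarrow> v i \<in> {0, 1::real}"
  shows "diff_in_means N x v =
    real N / (real N0 * real N1) * simple_random_sample.dev {1..N} {i \<in> {1..N}. v i = 1} N1 (arm N x 1)"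
proof -
  let ?A = "{i \<in> {1..N}. v i = 1}" and ?S = "arm N x 1"
  interpret simple_random_sample "{1..N}" ?A N1
    by unfold_locales (use size pos in auto)
  have sum: "(\<Sum>i\<in>B. v i) = real (card (B \<inter> ?A))" if "B \<subseteq> {1..N}" for B
  proof -
    have "(\<Sum>i\<in>B. v i) = (\<Sum>i\<in>B \<inter> ?A. 1)"
      by (rule sum.mono_neutral_cong_right) (use that v finite_subset[OF that] in blast)+
    then show ?thesis by simp
  qed
  have S: "?S \<subseteq> {1..N}" by (auto simp: arm_def)
  have "card (({1..N} - ?S) \<inter> ?A) = card (?A - ?S)" by (rule arg_cong[where f = card]) auto
  moreover have "?S \<in> samples" unfolding samples_def using S x(2) by blast
  ultimately have "real (card (({1..N} - ?S) \<inter> ?A)) = real (card ?A) - real (card (?S \<inter> ?A))"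
    by (simp only: card_A_minus)
  then have "diff_in_means N x v = real (card (?S \<inter> ?A)) / real N1 - (real (card ?A) - real (card (?S \<inter> ?A))) / real N0"
    unfolding diff_in_means_def card_arm_control x(2) unfolding arm_control
    by (subst (1 2) sum) (use S in auto)
  also have "\<dots> = real N / (real N0 * real N1) * dev ?S"
    unfolding dev_def card_atLeastAtMost using pos size
    by (simp add: divide_simps) (simp add: algebra_simps)
  finally show ?thesis .
qed

text \<open>The constant 1 has mean 1 in both arms and cancels. Complementing the outcomes thus
  turns lower tails into upper tails.\<close>

lemma diff_in_means_one_minus: "diff_in_means N x (\<lambda>i. 1 - v i) = - diff_in_means N x v"
  unfolding diff_in_means_def card_arm_control x(2) sum_subtractf
  using pos by (simp add: card_arm_control x(2)[unfolded One_nat_def] field_simps)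

end

text \<open>Since \<open>N - N1 = N0\<close>, the two expressions under the roots are reciprocal to
  each other. Dividing by the scale factor \<open>r^2\<close> turns \<open>r\<close> into
  \<open>1 / r\<close>.\<close>

lemma threshold_rescale:
  assumes "N = N0 + N1" "0 < N0" "0 < (N1::nat)"
  shows "z / 2 * sqrt (real N / (real N0 * real N1)) < real N / (real N0 * real N1) * d \<longleftrightarrow>
    z / 2 * sqrt (real N1 * (real N - real N1) / real N) < d"
proof -
  define r where "r = sqrt (real N / (real N0 * real N1))"
  have r: "0 < r" "real N / (real N0 * real N1) = r\<^sup>2" using assms by (simp_all add: r_def)
  have "sqrt (real N1 * (real N - real N1) / real N) = 1 / r"
    unfolding r_def using assms by (simp add: real_sqrt_divide mult.commute)
  then have "z / 2 * sqrt (real N1 * (real N - real N1) / real N) = z / 2 / r"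
    by simp
  then show ?thesis
    unfolding r_def[symmetric] r(2) using r(1) by (simp only:) (simp add: field_simps power2_eq_square)
qed

section \<open>Tail bounds along a sequence of experiments with growing arms\<close>

locale sampling_sequence =
  fixes M :: "nat \<Rightarrow> 'w measure" and N N1 N0 :: "nat \<Rightarrow> nat" and X :: "nat \<Rightarrow> 'w \<Rightarrow> nat \<Rightarrow> nat"
  assumes size: "\<And>n. N n = N0 n + N1 n"
    and sampling: "\<And>n. sampled_without_replacement (M n) (N n) (N1 n) (X n)"
    and regime: "filterlim (\<lambda>n. min (N1 n) (N0 n)) at_top sequentially"
begin

definition width :: "nat \<Rightarrow> real" where
  "width n = sqrt (real (N n) / (real (N0 n) * real (N1 n)))"

lemma eventually_nonempty_arms: "\<forall>\<^sub>F n in sequentially. 0 < N0 n \<and> 0 < N1 n"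
  using eventually_compose_filterlim[OF eventually_gt_at_top[of 0] regime] by (simp add: conj_commute)

text \<open>The expression under the root is \<open>1 / N1 + 1 / N0\<close>.\<close>

lemma width_tendsto_0: "width \<longlonglongrightarrow> 0"
proof -
  have lim: "filterlim (\<lambda>n. real (N0 n)) at_top sequentially" "filterlim (\<lambda>n. real (N1 n)) at_top sequentially"
    by (rule filterlim_compose[OF filterlim_real_sequentially], rule filterlim_at_top_mono[OF regime], simp)+
  have "(\<lambda>n. sqrt (1 / real (N1 n) + 1 / real (N0 n))) \<longlonglongrightarrow> sqrt (0 + 0)"
    by (intro tendsto_intros tendsto_divide_0[OF tendsto_const] filterlim_at_top_imp_at_infinity lim)
  moreover have "\<forall>\<^sub>F n in sequentially. sqrt (1 / real (N1 n) + 1 / real (N0 n)) = width n"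
    using eventually_nonempty_arms by eventually_elim (simp add: width_def size field_simps)
  ultimately show ?thesis by (auto intro: Lim_transform_eventually)
qed

context
  fixes n :: nat and v :: "nat \<Rightarrow> real"
  assumes arms: "0 < N0 n" "0 < N1 n" and v: "\<And>i. i \<in> {1..N n} \<Longrightarrow> v i \<in> {0, 1}"
begin

lemma prob_diff_in_means:
  "measure (M n) {\<omega> \<in> space (M n). R (diff_in_means (N n) (X n \<omega>) v)} =
    measure_pmf.prob (pmf_of_set {S. S \<subseteq> {1..N n} \<and> card S = N1 n})
      {S. R (real (N n) / (real (N0 n) * real (N1 n)) *
        simple_random_sample.dev {1..N n} {i \<in> {1..N n}. v i = 1} (N1 n) S)}"
proof (rule sampled_prob[OF sampling])
  show "N1 n \<le> N n" using size[of n] by simp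
qed (simp only: diff_in_means_binary[OF size arms _ _ v])

text \<open>The pointwise identity presupposes exactly \<open>N1\<close> treated units, which the
  sampling law guarantees almost surely but not for every \<open>\<omega>\<close>. Both sides are
  therefore compared through the law of the treated set.\<close>

lemma prob_diff_in_means_one_minus:
  "measure (M n) {\<omega> \<in> space (M n). R (diff_in_means (N n) (X n \<omega>) (\<lambda>i. 1 - v i))} =
   measure (M n) {\<omega> \<in> space (M n). R (- diff_in_means (N n) (X n \<omega>) v)}"
  unfolding prob_diff_in_means[of "\<lambda>d. R (- d)"]
proof (rule sampled_prob[OF sampling])
  show "N1 n \<le> N n" using size[of n] by simp
qed (simp only: diff_in_means_one_minus[OF size arms] diff_in_means_binary[OF size arms _ _ v])

end

lemma one_sided_tail:
  fixes v :: "nat \<Rightarrow> nat \<Rightarrow> real"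
  assumes v: "\<And>n i. i \<in> {1..N n} \<Longrightarrow> v n i \<in> {0, 1}" and "0 < z" "0 < \<epsilon>"
  shows "\<forall>\<^sub>F n in sequentially. measure (M n) {\<omega> \<in> space (M n).
      z / 2 * width n < diff_in_means (N n) (X n \<omega>) (v n)} < 1 - Phi z + \<epsilon>"
proof -
  obtain m where m: "\<And>n. m \<le> n \<Longrightarrow> 0 < N0 n \<and> 0 < N1 n"
    using eventually_nonempty_arms by (auto simp: eventually_sequentially)
  define A where "A n = {i \<in> {1..N n}. v n i = 1}" for n
  have srs: "simple_random_sample {1..N n} (A n) (N1 n)" if "m \<le> n" for n
    by unfold_locales (use size m[OF that] in \<open>auto simp: A_def\<close>)
  \<comment> \<open>A nonempty population is guaranteed only from \<open>m\<close> on, so the tail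
    lemma is applied to the shifted sequence.\<close>
  have "\<forall>\<^sub>F n in sequentially. measure_pmf.prob (simple_random_sample.P {1..N (n + m)} (N1 (n + m)))
      {S. z / 2 * sqrt (real (N1 (n + m)) * (real (card {1..N (n + m)}) - real (N1 (n + m))) / real (card {1..N (n + m)}))
        < simple_random_sample.dev {1..N (n + m)} (A (n + m)) (N1 (n + m)) S} < 1 - Phi z + \<epsilon>"
  proof (rule hypergeometric_upper_tail)
    show "filterlim (\<lambda>n. min (N1 (n + m)) (card {1..N (n + m)} - N1 (n + m))) at_top sequentially"
      using filterlim_compose[OF regime filterlim_add_const_nat_at_top[of m]] by (simp add: size)
  qed (use srs \<open>0 < z\<close> \<open>0 < \<epsilon>\<close> in auto)
  then have "\<forall>\<^sub>F n in sequentially. measure_pmf.prob (simple_random_sample.P {1..N n} (N1 n))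
      {S. z / 2 * sqrt (real (N1 n) * (real (N n) - real (N1 n)) / real (N n))
        < simple_random_sample.dev {1..N n} (A n) (N1 n) S} < 1 - Phi z + \<epsilon>"
    by (subst eventually_sequentially_seg[of _ m, symmetric]) simp
  then show ?thesis
    using eventually_ge_at_top[of m]
  proof eventually_elim
    case (elim n)
    interpret simple_random_sample "{1..N n}" "A n" "N1 n" by (rule srs[OF elim(2)])
    have arms: "0 < N0 n" "0 < N1 n" using m[OF elim(2)] by simp_all
    have "measure (M n) {\<omega> \<in> space (M n). z / 2 * width n < diff_in_means (N n) (X n \<omega>) (v n)} =
        measure_pmf.prob P {S. z / 2 * sqrt (real (N1 n) * (real (N n) - real (N1 n)) / real (N n)) < dev S}"
      unfolding width_def threshold_rescale[OF size arms, symmetric] P_def samples_def A_def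
      by (rule prob_diff_in_means[OF arms]) (rule v)
    then show ?case using elim(1) by simp
  qed
qed

text \<open>Union bound over the two tails, each with slack \<open>\<epsilon> / 2\<close>; the lower
  tail is the upper tail of the complementary outcomes.\<close>

lemma two_sided_tail:
  fixes v :: "nat \<Rightarrow> nat \<Rightarrow> real"
  assumes v: "\<And>n i. i \<in> {1..N n} \<Longrightarrow> v n i \<in> {0, 1}" and "0 < z" "0 < \<epsilon>"
  shows "\<forall>\<^sub>F n in sequentially. measure (M n) {\<omega> \<in> space (M n).
      z / 2 * width n < \<bar>diff_in_means (N n) (X n \<omega>) (v n)\<bar>} < 2 * (1 - Phi z) + \<epsilon>"
proof -
  have "\<forall>\<^sub>F n in sequentially. measure (M n) {\<omega> \<in> space (M n).
      z / 2 * width n < diff_in_means (N n) (X n \<omega>) (v n)} < 1 - Phi z + \<epsilon> / 2"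
    by (rule one_sided_tail[OF v]) (use assms in auto)
  moreover have "\<forall>\<^sub>F n in sequentially. measure (M n) {\<omega> \<in> space (M n).
      z / 2 * width n < diff_in_means (N n) (X n \<omega>) (\<lambda>i. 1 - v n i)} < 1 - Phi z + \<epsilon> / 2"
  proof (rule one_sided_tail)
    show "1 - v n i \<in> {0, 1}" if "i \<in> {1..N n}" for n i using v[OF that] by auto
  qed (use assms in auto)
  ultimately show ?thesis
    using eventually_nonempty_arms
  proof eventually_elim
    case (elim n)
    let ?d = "\<lambda>\<omega>. diff_in_means (N n) (X n \<omega>) (v n)"
    interpret prob_space "M n" using sampling[of n] by (simp add: sampled_without_replacement_def)
    note sets = sampled_measurable[OF sampling]
    have neg: "measure (M n) {\<omega> \<in> space (M n). z / 2 * width n < - ?d \<omega>} < 1 - Phi z + \<epsilon> / 2"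
    proof -
      have "measure (M n) {\<omega> \<in> space (M n). z / 2 * width n < diff_in_means (N n) (X n \<omega>) (\<lambda>i. 1 - v n i)} =
          measure (M n) {\<omega> \<in> space (M n). z / 2 * width n < - ?d \<omega>}"
        by (rule prob_diff_in_means_one_minus) (use elim(3) v in blast)+
      then show ?thesis using elim(2) by simp
    qed
    have "measure (M n) {\<omega> \<in> space (M n). z / 2 * width n < \<bar>?d \<omega>\<bar>} \<le>
      measure (M n) ({\<omega> \<in> space (M n). z / 2 * width n < ?d \<omega>} \<union> {\<omega> \<in> space (M n). z / 2 * width n < - ?d \<omega>})"
      by (intro finite_measure_mono sets.Un sets) auto
    also have "\<dots> \<le> measure (M n) {\<omega> \<in> space (M n). z / 2 * width n < ?d \<omega>} +
        measure (M n) {\<omega> \<in> space (M n). z / 2 * width n < - ?d \<omega>}"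
      by (intro measure_Un_le sets)
    finally show ?case using neg elim(1) by simp
  qed
qed

lemma liminf_coverage:
  assumes "\<And>\<epsilon>. 0 < \<epsilon> \<Longrightarrow> \<forall>\<^sub>F n in sequentially. measure (M n) {\<omega> \<in> space (M n). \<not> Q n (X n \<omega>)} < \<alpha> + \<epsilon>"
  shows "ereal (1 - \<alpha>) \<le> liminf (\<lambda>n. ereal (measure (M n) {\<omega> \<in> space (M n). Q n (X n \<omega>)}))"
proof (rule le_Liminf_iff[THEN iffD2], intro allI impI)
  fix y assume "y < ereal (1 - \<alpha>)"
  then obtain c where c: "y < ereal c" "c < 1 - \<alpha>" using ereal_dense2[of y "ereal (1 - \<alpha>)"] by auto
  \<comment> \<open>The slack is chosen so that non-coverage falls below \<open>1 - c\<close>, that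
    is, coverage exceeds \<open>c\<close>.\<close>
  have "\<forall>\<^sub>F n in sequentially. measure (M n) {\<omega> \<in> space (M n). \<not> Q n (X n \<omega>)} < \<alpha> + (1 - \<alpha> - c)"
    by (rule assms) (use c in simp)
  then show "\<forall>\<^sub>F n in sequentially. y < ereal (measure (M n) {\<omega> \<in> space (M n). Q n (X n \<omega>)})"
  proof eventually_elim
    case (elim n)
    interpret prob_space "M n" using sampling[of n] by (simp add: sampled_without_replacement_def)
    have "{\<omega> \<in> space (M n). \<not> Q n (X n \<omega>)} = space (M n) - {\<omega> \<in> space (M n). Q n (X n \<omega>)}" by auto
    then have "c < measure (M n) {\<omega> \<in> space (M n). Q n (X n \<omega>)}"
      using prob_compl[OF sampled_measurable[OF sampling[of n], of "Q n"]] elim by simp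
    then have "ereal c < ereal (measure (M n) {\<omega> \<in> space (M n). Q n (X n \<omega>)})" by simp
    with c(1) show ?case by (rule less_trans)
  qed
qed

end

section \<open>Coverage of the two bounds, and consistency\<close>

theorem theorem4:
  fixes M :: "nat \<Rightarrow> 'w measure"
    and N N1 N0 :: "nat \<Rightarrow> nat"
    and X :: "nat \<Rightarrow> 'w \<Rightarrow> nat \<Rightarrow> nat"
    and f :: "nat \<Rightarrow> nat \<Rightarrow> (nat \<Rightarrow> nat) \<Rightarrow> real"
  assumes size: "\<And>n. N n = N0 n + N1 n"
    and sampling: "\<And>n. sampled_without_replacement (M n) (N n) (N1 n) (X n)"
    and binary: "\<And>n. binary_outcomes (N n) (f n)"
    and regime: "filterlim (\<lambda>n. min (N1 n) (N0 n)) at_top sequentially"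
  shows
    "(\<forall>\<alpha>. 0 < \<alpha> \<and> \<alpha> < 1/2 \<longrightarrow>
        liminf (\<lambda>n. ereal (measure (M n) {\<omega> \<in> space (M n).
            tau_CAT (N n) (f n) (X n \<omega>) \<ge> Delta_Y (N n) (f n) (X n \<omega>)
              - z_quantile (1 - \<alpha>) / 2 * sqrt (real (N n) / (real (N0 n) * real (N1 n)))}))
          \<ge> ereal (1 - \<alpha>))
     \<and> (\<forall>\<alpha>. 0 < \<alpha> \<and> \<alpha> < 1 \<longrightarrow>
        liminf (\<lambda>n. ereal (measure (M n) {\<omega> \<in> space (M n).
            \<bar>tau_CAT (N n) (f n) (X n \<omega>) - Delta_Y (N n) (f n) (X n \<omega>)\<bar>
              \<le> z_quantile (1 - \<alpha> / 2) / 2 * sqrt (real (N n) / (real (N0 n) * real (N1 n)))}))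
          \<ge> ereal (1 - \<alpha>))
     \<and> little_oP_one M (\<lambda>n \<omega>. Delta_Y (N n) (f n) (X n \<omega>) - tau_CAT (N n) (f n) (X n \<omega>))"
proof -
  interpret sampling_sequence M N N1 N0 X
    using size sampling regime by unfold_locales
  \<comment> \<open>The outcomes under full control are fixed binary numbers for each
    \<open>n\<close>. The interference in \<open>f\<close> thus enters only through
    \<open>Delta_Y\<close>, which cancels from \<open>tau_CAT - Delta_Y\<close>.\<close>
  define v where "v n i = f n i (full_control (N n))" for n i
  have v: "v n i \<in> {0, 1}" if "i \<in> {1..N n}" for n i
  proof -
    have "full_control (N n) \<in> assignments (N n)" by (auto simp: full_control_def assignments_def)
    then show ?thesis using binary[of n] that unfolding v_def binary_outcomes_def by blast
  qed
  have tau: "tau_CAT (N n) (f n) x = Delta_Y (N n) (f n) x - diff_in_means (N n) x (v n)" for n x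
    by (simp add: tau_CAT_def Delta_xi_def v_def[abs_def])
  \<comment> \<open>Since \<open>Phi\<close> is at least \<open>1 - \<alpha> / 2\<close> at the
    quantile, the two tails together contribute at most \<open>\<alpha>\<close> in the
    limit.\<close>
  have two_sided: "\<forall>\<^sub>F n in sequentially. measure (M n) {\<omega> \<in> space (M n).
      z_quantile (1 - \<alpha> / 2) / 2 * width n < \<bar>diff_in_means (N n) (X n \<omega>) (v n)\<bar>} < \<alpha> + \<epsilon>"
    if "0 < \<alpha>" "\<alpha> < 1" "0 < \<epsilon>" for \<alpha> \<epsilon>
    using two_sided_tail[where v = v, OF v, where z = "z_quantile (1 - \<alpha> / 2)" and \<epsilon> = \<epsilon>] z_quantile_pos[of "1 - \<alpha> / 2"]
      Phi_z_quantile[of "1 - \<alpha> / 2"] that by (auto elim!: eventually_mono)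
  show ?thesis
    unfolding width_def[symmetric]
  proof (intro conjI allI impI)
    fix \<alpha> :: real assume \<alpha>: "0 < \<alpha> \<and> \<alpha> < 1 / 2"
    show "ereal (1 - \<alpha>) \<le> liminf (\<lambda>n. ereal (measure (M n) {\<omega> \<in> space (M n).
        Delta_Y (N n) (f n) (X n \<omega>) - z_quantile (1 - \<alpha>) / 2 * width n \<le> tau_CAT (N n) (f n) (X n \<omega>)}))"
    proof (rule liminf_coverage)
      fix \<epsilon> :: real assume "0 < \<epsilon>"
      then show "\<forall>\<^sub>F n in sequentially. measure (M n) {\<omega> \<in> space (M n).
          \<not> Delta_Y (N n) (f n) (X n \<omega>) - z_quantile (1 - \<alpha>) / 2 * width n \<le> tau_CAT (N n) (f n) (X n \<omega>)} < \<alpha> + \<epsilon>"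
        using one_sided_tail[where v = v, OF v, where z = "z_quantile (1 - \<alpha>)" and \<epsilon> = \<epsilon>] z_quantile_pos[of "1 - \<alpha>"]
          Phi_z_quantile[of "1 - \<alpha>"] \<alpha> by (auto simp: tau not_le elim!: eventually_mono)
    qed
  next
    fix \<alpha> :: real assume \<alpha>: "0 < \<alpha> \<and> \<alpha> < 1"
    show "ereal (1 - \<alpha>) \<le> liminf (\<lambda>n. ereal (measure (M n) {\<omega> \<in> space (M n).
        \<bar>tau_CAT (N n) (f n) (X n \<omega>) - Delta_Y (N n) (f n) (X n \<omega>)\<bar> \<le> z_quantile (1 - \<alpha> / 2) / 2 * width n}))"
      by (rule liminf_coverage) (use two_sided[of \<alpha>] \<alpha> in \<open>simp add: tau not_le\<close>)
  next
    show "little_oP_one M (\<lambda>n \<omega>. Delta_Y (N n) (f n) (X n \<omega>) - tau_CAT (N n) (f n) (X n \<omega>))"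
      unfolding little_oP_one_def
    proof (intro allI impI)
      fix \<epsilon> :: real assume "0 < \<epsilon>"
      show "(\<lambda>n. measure (M n) {\<omega> \<in> space (M n).
          \<epsilon> < \<bar>Delta_Y (N n) (f n) (X n \<omega>) - tau_CAT (N n) (f n) (X n \<omega>)\<bar>}) \<longlonglongrightarrow> 0"
      proof (rule order_tendstoI)
        fix \<delta> :: real assume "0 < \<delta>"
        \<comment> \<open>The level is held fixed while the width shrinks below
          \<open>\<epsilon>\<close>; then a deviation beyond \<open>\<epsilon>\<close> is a case of
          non-coverage, of probability below \<open>\<alpha> + \<delta> / 2\<close>. The minimum
          with 1/2 keeps \<open>\<alpha>\<close> below 1.\<close>
        define \<alpha> where "\<alpha> = min (1 / 2) (\<delta> / 2)"
        have \<alpha>: "0 < \<alpha>" "\<alpha> < 1" "\<alpha> + \<delta> / 2 \<le> \<delta>" using \<open>0 < \<delta>\<close> by (auto simp: \<alpha>_def)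
        have "(\<lambda>n. z_quantile (1 - \<alpha> / 2) / 2 * width n) \<longlonglongrightarrow> z_quantile (1 - \<alpha> / 2) / 2 * 0"
          by (intro tendsto_intros width_tendsto_0)
        then have "\<forall>\<^sub>F n in sequentially. z_quantile (1 - \<alpha> / 2) / 2 * width n < \<epsilon>"
          by (rule order_tendstoD) (use \<open>0 < \<epsilon>\<close> in simp)
        moreover have "\<forall>\<^sub>F n in sequentially. measure (M n) {\<omega> \<in> space (M n).
            z_quantile (1 - \<alpha> / 2) / 2 * width n < \<bar>diff_in_means (N n) (X n \<omega>) (v n)\<bar>} < \<alpha> + \<delta> / 2"
          by (rule two_sided) (use \<alpha> \<open>0 < \<delta>\<close> in auto)
        ultimately show "\<forall>\<^sub>F n in sequentially. measure (M n) {\<omega> \<in> space (M n).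
            \<epsilon> < \<bar>Delta_Y (N n) (f n) (X n \<omega>) - tau_CAT (N n) (f n) (X n \<omega>)\<bar>} < \<delta>"
        proof eventually_elim
          case (elim n)
          interpret prob_space "M n" using sampling[of n] by (simp add: sampled_without_replacement_def)
          have "measure (M n) {\<omega> \<in> space (M n). \<epsilon> < \<bar>Delta_Y (N n) (f n) (X n \<omega>) - tau_CAT (N n) (f n) (X n \<omega>)\<bar>}
            \<le> measure (M n) {\<omega> \<in> space (M n).
              z_quantile (1 - \<alpha> / 2) / 2 * width n < \<bar>diff_in_means (N n) (X n \<omega>) (v n)\<bar>}"
            by (rule finite_measure_mono[OF _ sampled_measurable[OF sampling]]) (use elim(1) in \<open>auto simp: tau\<close>)
          then show ?case using elim(2) \<alpha>(3) by linarith
        qed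
      qed (auto intro!: always_eventually elim: less_le_trans)
    qed
  qed
qed

end
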